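(* Let $G$ be a graph with $t$ vertices, $m$ edges and maximum degree $\Delta$, let $w$ be a positive integer, and let $0<p<1$. Set $q=1-p^2(1-p)^w$ and $$D=m\binom{t-2}{w}-\bigl(m-(w+2)\Delta\bigr)\binom{t-w-4}{w}.$$ Then $$N(G,w;1)\leq\left\lceil\frac{\log_2\bigl(e(D+1)\bigr)}{-\log_2 q}\right\rceil.$$
   Context: For a graph $G$, a collection $\{A_1,\ldots,A_n\}$ of subsets of $V(G)$ is a $(w,d)$-covering of $G$ if for every edge $\{u,v\}$ and every $w$-subset $W\subseteq V(G)$ disjoint from $\{u,v\}$ there are at least $d$ sets $A_j$ with $\{u,v\}\subseteq A_j$ and $W\cap A_j=\emptyset$; $N(G,w;d)$ is the minimum size of a $(w,d)$-covering of $G$. Here $e$ is Euler's number. *)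

theory Defs
  imports Complex_Main
begin

text \<open>Finite simple undirected graphs with vertex set V and edge set E.\<close>

definition simple_graph :: "'a set \<Rightarrow> 'a set set \<Rightarrow> bool" where
  "simple_graph V E \<longleftrightarrow> finite V \<and> (\<forall>e\<in>E. e \<subseteq> V \<and> card e = 2)"

definition degree :: "'a set set \<Rightarrow> 'a \<Rightarrow> nat" where
  "degree E v = card {e \<in> E. v \<in> e}"

text \<open>The inserted 0 only matters for the graph without vertices.\<close>

definition max_degree :: "'a set \<Rightarrow> 'a set set \<Rightarrow> nat" where
  "max_degree V E = Max (insert 0 (degree E ` V))"

text \<open>
  A collection A_1, ..., A_n is a list, i.e. an indexed family: repeated members are
  allowed and are counted with multiplicity.
\<close>

definition is_covering :: "'a set \<Rightarrow> 'a set set \<Rightarrow> nat \<Rightarrow> nat \<Rightarrow> 'a set list \<Rightarrow> bool" where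
  "is_covering V E w d As \<longleftrightarrow>
     (\<forall>A\<in>set As. A \<subseteq> V) \<and>
     (\<forall>u v W. {u, v} \<in> E \<and> W \<subseteq> V \<and> card W = w \<and> W \<inter> {u, v} = {} \<longrightarrow>
        d \<le> card {j. j < length As \<and> {u, v} \<subseteq> As ! j \<and> W \<inter> As ! j = {}})"

definition covering_number :: "'a set \<Rightarrow> 'a set set \<Rightarrow> nat \<Rightarrow> nat \<Rightarrow> nat" where
  "covering_number V E w d = (LEAST n. \<exists>As. length As = n \<and> is_covering V E w d As)"

text \<open>
  Coverings always exist (take every edge d times), so the minimum above is attained.
\<close>

lemma covering_exists:
  assumes "simple_graph V E"
  shows "\<exists>As. is_covering V E w d As"
proof -
  have "E \<subseteq> Pow V" "finite V"
    using assms by (auto simp: simple_graph_def)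
  then have "finite E"
    using finite_subset by blast
  then obtain es where es: "set es = E"
    using finite_list by blast
  define As where "As = concat (map (replicate d) es)"
  have "d \<le> card {j. j < length As \<and> e \<subseteq> As ! j \<and> W \<inter> As ! j = {}}"
    if "e \<in> E" "W \<inter> e = {}" for e W
  proof -
    obtain ys zs where "es = ys @ e # zs"
      using \<open>e \<in> E\<close> es split_list by metis
    then have "d \<le> length (filter (\<lambda>A. e \<subseteq> A \<and> W \<inter> A = {}) As)"
      using that by (simp add: As_def)
    then show ?thesis
      by (simp add: length_filter_conv_card)
  qed
  moreover have "\<forall>A\<in>set As. A \<subseteq> V"
    using \<open>E \<subseteq> Pow V\<close> es by (auto simp: As_def)
  ultimately have "is_covering V E w d As"
    unfolding is_covering_def by blast
  then show ?thesis ..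
qed

lemma covering_number_attained:
  assumes "simple_graph V E"
  shows "\<exists>As. length As = covering_number V E w d \<and> is_covering V E w d As"
  unfolding covering_number_def
  by (rule LeastI_ex) (use covering_exists[OF assms] in blast)

text \<open>
  Binomial coefficient with integer upper index n, equal to 0 for n < 0 (the number of
  k-subsets when no n-set exists), as opposed to the polynomial extension.
\<close>

definition int_choose :: "int \<Rightarrow> nat \<Rightarrow> nat" where
  "int_choose n k = (if n < 0 then 0 else nat n choose k)"

end

theory Submission
  imports Defs "HOL-Probability.Product_PMF"
begin

text \<open>
  Choose n random subsets of V, putting every vertex into every set independently with
  probability p.  A pair (e, W) of an edge and a disjoint w-set is not served with probability
  \<open>q ^ n\<close>, and this event is independent of all those pairs that avoid \<open>e \<union> W\<close>.  At most
  \<open>(w + 2) * \<Delta>\<close> edges meet \<open>e \<union> W\<close>, so counting the pairs that avoid it leaves at most D pairs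
  on which the event may depend, and the symmetric local lemma gives a covering as soon as
  \<open>exp 1 * q ^ n * (D + 1) \<le> 1\<close>.
\<close>

section \<open>The symmetric Lovasz local lemma\<close>

lemma (in prob_space) prob_diff_Union_insert:
  assumes "finite S" "A ` insert k S \<subseteq> events"
  shows "prob (space M - \<Union>(A ` insert k S)) =
         prob (space M - \<Union>(A ` S)) - prob (A k \<inter> (space M - \<Union>(A ` S)))"
proof -
  have "\<Union>(A ` S) \<in> events" "A k \<in> events"
    using assms by auto
  moreover have "space M - \<Union>(A ` insert k S) =
      (space M - \<Union>(A ` S)) - A k \<inter> (space M - \<Union>(A ` S))"
    by auto
  ultimately show ?thesis
    by (metis (no_types, lifting) finite_measure_Diff inf_le2 sets.Diff sets.Int sets.top)
qed

text \<open>
  The induction behind the local lemma, with the conditional probabilities cleared of denominators.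
\<close>

lemma (in prob_space) local_lemma_step:
  fixes A :: "'i \<Rightarrow> 'a set" and x :: real
  assumes fin: "finite I" and ev: "A ` I \<subseteq> events"
    and x: "0 \<le> x" "x < 1"
    and prob_le: "\<And>i. i \<in> I \<Longrightarrow> prob (A i) \<le> x * (1 - x) ^ d"
    and deg: "\<And>i. i \<in> I \<Longrightarrow> card (\<Gamma> i \<inter> I) \<le> d"
    and indep: "\<And>i S. i \<in> I \<Longrightarrow> S \<subseteq> I - insert i (\<Gamma> i) \<Longrightarrow>
      prob (A i \<inter> (space M - \<Union>(A ` S))) = prob (A i) * prob (space M - \<Union>(A ` S))"
    and "S \<subseteq> I" "i \<in> I"
  shows "prob (A i \<inter> (space M - \<Union>(A ` S))) \<le> x * prob (space M - \<Union>(A ` S))"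
  using \<open>S \<subseteq> I\<close> \<open>i \<in> I\<close>
proof (induction "card S" arbitrary: S i rule: less_induct)
  case less
  show ?case
  proof (cases "i \<in> S")
    case True
    then have "A i \<inter> (space M - \<Union>(A ` S)) = {}"
      by auto
    with x show ?thesis
      by simp
  next
    case False
    \<comment> \<open>\<open>N T\<close> is the event that no \<open>A k\<close> with
      \<open>k\<close> in \<open>T\<close> happens.\<close>
    define N where "N T = space M - \<Union>(A ` T)" for T
    have finS: "finite S"
      using fin less.prems(1) by (rule finite_subset[rotated])
    have N_ev: "N T \<in> events" if "T \<subseteq> S" for T
      unfolding N_def using that less.prems ev finS finite_subset
      by (intro sets.Diff sets.finite_UN) auto
    \<comment> \<open>Since \<open>i\<close> is not in \<open>S\<close>, \<open>indep\<close>
      applies to \<open>A i\<close> and \<open>N far\<close>.\<close>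
    define far where "far = S - \<Gamma> i"
    \<comment> \<open>The neighbours in \<open>U\<close> are put back one at a time, each costing at
      most a factor \<open>1 - x\<close>. The outer induction hypothesis applies to
      \<open>far \<union> U\<close> because this set misses the element \<open>k\<close> of
      \<open>S\<close> that comes next.\<close>
    have lower: "(1 - x) ^ card U * prob (N far) \<le> prob (N (far \<union> U))"
      if "U \<subseteq> S \<inter> \<Gamma> i" for U
    proof -
      have "finite U"
        using that finS by (meson finite_Int finite_subset)
      then show ?thesis
        using that
      proof (induction U)
        case empty
        then show ?case by simp
      next
        case (insert k U)
        have k: "k \<in> S" "k \<notin> far \<union> U"
          using insert by (auto simp: far_def)
        have sub: "far \<union> U \<subseteq> S"
          using insert by (auto simp: far_def)
        have "card (far \<union> U) < card S"
          by (rule psubset_card_mono[OF finS]) (use k sub in auto)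
        then have le: "prob (A k \<inter> N (far \<union> U)) \<le> x * prob (N (far \<union> U))"
          unfolding N_def using less.hyps[of "far \<union> U" k] sub k less.prems by auto
        have "prob (N (far \<union> insert k U)) = prob (N (far \<union> U)) - prob (A k \<inter> N (far \<union> U))"
          using prob_diff_Union_insert[of "far \<union> U" A k] sub k less.prems ev finS
          unfolding N_def by (auto dest: finite_subset)
        then have "(1 - x) * prob (N (far \<union> U)) \<le> prob (N (far \<union> insert k U))"
          using le by (simp add: algebra_simps)
        moreover have "(1 - x) * ((1 - x) ^ card U * prob (N far)) \<le> (1 - x) * prob (N (far \<union> U))"
          using insert x by (intro mult_left_mono) auto
        ultimately show ?case
          using insert by (simp add: mult.assoc)
      qed
    qed
    have "card (S \<inter> \<Gamma> i) \<le> card (\<Gamma> i \<inter> I)"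
      using less.prems(1) fin by (intro card_mono) auto
    then have "card (S \<inter> \<Gamma> i) \<le> d"
      using deg[OF less.prems(2)] by linarith
    then have pow: "(1 - x) ^ d \<le> (1 - x) ^ card (S \<inter> \<Gamma> i)"
      using x by (intro power_decreasing) auto
    \<comment> \<open>Forgetting the neighbours gives room to use independence. The factor
      \<open>(1 - x) ^ d\<close> from \<open>prob_le\<close> then pays, through
      \<open>lower\<close>, for returning from \<open>far\<close> to \<open>S\<close>.\<close>
    have "prob (A i \<inter> N S) \<le> prob (A i \<inter> N far)"
      using N_ev[of far] ev less.prems
      by (intro finite_measure_mono) (auto simp: N_def far_def)
    also have "\<dots> = prob (A i) * prob (N far)"
      unfolding N_def using less.prems False by (intro indep) (auto simp: far_def)
    also have "\<dots> \<le> x * (1 - x) ^ d * prob (N far)"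
      using prob_le[OF less.prems(2)] by (intro mult_right_mono) auto
    also have "\<dots> \<le> x * ((1 - x) ^ card (S \<inter> \<Gamma> i) * prob (N far))"
      unfolding mult.assoc using pow x by (intro mult_left_mono mult_right_mono) auto
    also have "\<dots> \<le> x * prob (N (far \<union> S \<inter> \<Gamma> i))"
      using lower[of "S \<inter> \<Gamma> i"] x by (intro mult_left_mono) auto
    also have "far \<union> S \<inter> \<Gamma> i = S"
      by (auto simp: far_def)
    finally show ?thesis
      by (simp add: N_def)
  qed
qed

text \<open>The weight 1/(d+1) maximises x (1-x)^d. With it, (1-x)^d is the reciprocal of (1 +
  1/d)^d, which is at most e. For \<open>d = 0\<close> it would be 1, violating
  \<open>x < 1\<close>, so 1/e is taken instead.\<close>

lemma local_lemma_weight: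
  obtains x :: real where "0 \<le> x" "x < 1" "1 / (exp 1 * (real d + 1)) \<le> x * (1 - x) ^ d"
proof (cases "d = 0")
  case True
  show ?thesis
    by (rule that[of "1 / exp 1"]) (auto simp: True)
next
  case False
  define x :: real where "x = 1 / (real d + 1)"
  have "(1 + 1 / real d) ^ d \<le> exp 1"
    using exp_ge_one_plus_x_over_n_power_n[of d 1] False by simp
  moreover have "1 - x = 1 / (1 + 1 / real d)"
    using False by (simp add: x_def field_simps)
  ultimately have "1 / exp 1 \<le> (1 - x) ^ d"
    using False by (auto simp: power_divide intro!: divide_left_mono mult_pos_pos zero_less_power
        add_pos_pos)
  then have "x * (1 / exp 1) \<le> x * (1 - x) ^ d"
    by (intro mult_left_mono) (auto simp: x_def)
  moreover have "x * (1 / exp 1) = 1 / (exp 1 * (real d + 1))"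
    by (simp add: x_def)
  ultimately have "1 / (exp 1 * (real d + 1)) \<le> x * (1 - x) ^ d"
    by metis
  then show ?thesis
    by (rule that[rotated 2]) (use False in \<open>auto simp: x_def\<close>)
qed

text \<open>By \<open>local_lemma_step\<close>, avoiding one more event costs at most a factor
  \<open>1 - x\<close>, so all events are avoided with probability at least
  \<open>(1 - x) ^ card I\<close>. The set \<open>\<Gamma> i\<close> may contain \<open>i\<close>
  itself, and then \<open>d\<close> counts it too.\<close>

theorem (in prob_space) symmetric_local_lemma:
  fixes A :: "'i \<Rightarrow> 'a set" and P :: real
  assumes fin: "finite I" and ev: "A ` I \<subseteq> events"
    and prob_le: "\<And>i. i \<in> I \<Longrightarrow> prob (A i) \<le> P"
    and deg: "\<And>i. i \<in> I \<Longrightarrow> card (\<Gamma> i \<inter> I) \<le> d"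
    and indep: "\<And>i S. i \<in> I \<Longrightarrow> S \<subseteq> I - insert i (\<Gamma> i) \<Longrightarrow>
      prob (A i \<inter> (space M - \<Union>(A ` S))) = prob (A i) * prob (space M - \<Union>(A ` S))"
    and P: "exp 1 * P * (real d + 1) \<le> 1"
  shows "0 < prob (space M - \<Union>(A ` I))"
proof -
  obtain x :: real
    where x: "0 \<le> x" "x < 1" and w: "1 / (exp 1 * (real d + 1)) \<le> x * (1 - x) ^ d"
    by (rule local_lemma_weight)
  have "P \<le> 1 / (exp 1 * (real d + 1))"
    using P by (subst pos_le_divide_eq) (auto simp: mult_ac intro!: mult_pos_pos)
  then have le: "prob (A i) \<le> x * (1 - x) ^ d" if "i \<in> I" for i
    using prob_le[OF that] w by linarith
  have "(1 - x) ^ card S \<le> prob (space M - \<Union>(A ` S))" if "S \<subseteq> I" for S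
    using finite_subset[OF that fin] that
  proof (induction S)
    case empty
    then show ?case by (simp add: prob_space)
  next
    case (insert k S)
    have "prob (A k \<inter> (space M - \<Union>(A ` S))) \<le> x * prob (space M - \<Union>(A ` S))"
      by (rule local_lemma_step[OF fin ev x le deg indep]) (use insert in auto)
    moreover have "prob (space M - \<Union>(A ` insert k S)) =
         prob (space M - \<Union>(A ` S)) - prob (A k \<inter> (space M - \<Union>(A ` S)))"
      using insert ev by (intro prob_diff_Union_insert) auto
    moreover have "(1 - x) * (1 - x) ^ card S \<le> (1 - x) * prob (space M - \<Union>(A ` S))"
      using insert x by (intro mult_left_mono) auto
    ultimately show ?case
      using insert by (simp add: algebra_simps)
  qed
  from this[of I] x show ?thesis
    by (smt (verit) subset_refl zero_less_power)
qed

section \<open>Independence of events on disjoint coordinates\<close>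

text \<open>Under a \<open>pmf\<close> every set is an event, so being determined by the coordinates
  in \<open>A\<close> can be stated without a sigma-algebra. One implication suffices, as
  \<open>f\<close> and \<open>g\<close> can be swapped.\<close>

definition depends_on :: "'i set \<Rightarrow> ('i \<Rightarrow> 'b) set \<Rightarrow> bool" where
  "depends_on A X \<longleftrightarrow> (\<forall>f g. (\<forall>x\<in>A. f x = g x) \<longrightarrow> f \<in> X \<longrightarrow> g \<in> X)"

lemma depends_onD: "depends_on A X \<Longrightarrow> (\<And>x. x \<in> A \<Longrightarrow> f x = g x) \<Longrightarrow> f \<in> X \<longleftrightarrow> g \<in> X"
  unfolding depends_on_def by metis

lemma depends_on_mono: "depends_on A X \<Longrightarrow> A \<subseteq> B \<Longrightarrow> depends_on B X"
  unfolding depends_on_def by blast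

lemma depends_on_Compl: "depends_on A X \<Longrightarrow> depends_on A (- X)"
  unfolding depends_on_def by (metis ComplD ComplI)

lemma depends_on_UN: "(\<And>i. i \<in> I \<Longrightarrow> depends_on A (X i)) \<Longrightarrow> depends_on A (\<Union>i\<in>I. X i)"
  unfolding depends_on_def by blast

lemma depends_on_INT: "(\<And>i. i \<in> I \<Longrightarrow> depends_on A (X i)) \<Longrightarrow> depends_on A (\<Inter>i\<in>I. X i)"
  unfolding depends_on_def by blast

text \<open>Cutting \<open>A\<close> and \<open>B\<close> down to the supports changes no
  probability and makes them countable, which is where the product rule applies.\<close>

lemma prob_pair_pmf_Times:
  "measure_pmf.prob (pair_pmf M N) (A \<times> B) = measure_pmf.prob M A * measure_pmf.prob N B"
proof -
  have "measure_pmf.prob (pair_pmf M N) (A \<times> B) =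
        measure_pmf.prob (pair_pmf M N) ((A \<inter> set_pmf M) \<times> (B \<inter> set_pmf N))"
    by (subst measure_Int_set_pmf[symmetric])
      (auto simp: set_pair_pmf intro!: arg_cong[where f = "measure_pmf.prob _"])
  also have "\<dots> = measure_pmf.prob M (A \<inter> set_pmf M) * measure_pmf.prob N (B \<inter> set_pmf N)"
    by (intro measure_pmf_prob_product) auto
  finally show ?thesis
    by (simp add: measure_Int_set_pmf)
qed

text \<open>A sample on \<open>I\<close> is glued from independent samples on \<open>A\<close> and
  \<open>I - A\<close>. The glued function agrees with the first on \<open>A\<close> and with the
  second on \<open>B\<close>, so \<open>X\<close> and \<open>Y\<close> pull back to a strip in one
  component each.\<close>

lemma Pi_pmf_indep:
  assumes "finite I" "A \<subseteq> I" "B \<subseteq> I" "A \<inter> B = {}" "depends_on A X" "depends_on B Y"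
  shows "measure_pmf.prob (Pi_pmf I dflt p) (X \<inter> Y) =
         measure_pmf.prob (Pi_pmf I dflt p) X * measure_pmf.prob (Pi_pmf I dflt p) Y"
proof -
  let ?P = "Pi_pmf A dflt p" and ?Q = "Pi_pmf (I - A) dflt p"
  let ?h = "\<lambda>(f, g) x. if x \<in> A then f x else g x"
  have finA: "finite A"
    using assms finite_subset by blast
  have I: "Pi_pmf I dflt p = map_pmf ?h (pair_pmf ?P ?Q)"
    using Pi_pmf_union[of A "I - A" dflt p] assms finA
    by (simp add: Un_absorb1 Un_Diff_cancel)
  have X: "?h (f, g) \<in> X \<longleftrightarrow> f \<in> X" for f g
    using assms by (intro depends_onD[of A]) auto
  have Y: "?h (f, g) \<in> Y \<longleftrightarrow> g \<in> Y" for f g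
    using assms by (intro depends_onD[of B]) auto
  have "?h -` (X \<inter> Y) = X \<times> Y" "?h -` X = X \<times> UNIV" "?h -` Y = UNIV \<times> Y"
    using X Y by auto
  then show ?thesis
    by (simp add: I prob_pair_pmf_Times)
qed

section \<open>Probability that random sets fail to serve a pair\<close>

text \<open>The value \<open>f (v, j)\<close> tells whether vertex \<open>v\<close> lies in the
  \<open>j\<close>-th random set.\<close>

definition separates :: "'a set \<Rightarrow> 'a set \<Rightarrow> nat \<Rightarrow> ('a \<times> nat \<Rightarrow> bool) set" where
  "separates e W j = {f. (\<forall>v\<in>e. f (v, j)) \<and> (\<forall>v\<in>W. \<not> f (v, j))}"

definition never_separates :: "'a set \<Rightarrow> 'a set \<Rightarrow> nat \<Rightarrow> ('a \<times> nat \<Rightarrow> bool) set" where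
  "never_separates e W n = (\<Inter>j\<in>{..<n}. - separates e W j)"

lemma depends_on_separates: "depends_on ((e \<union> W) \<times> {j}) (separates e W j)"
  unfolding depends_on_def separates_def by auto

lemma depends_on_never_separates: "depends_on ((e \<union> W) \<times> {..<n}) (never_separates e W n)"
  unfolding never_separates_def
  by (intro depends_on_INT depends_on_Compl depends_on_mono[OF depends_on_separates]) auto

text \<open>The event is a box \<open>Pi ?I B\<close>: coordinates over \<open>e\<close> are pinned
  to \<open>True\<close>, those over \<open>W\<close> to \<open>False\<close>, and the free ones
  contribute a factor 1.\<close>

lemma prob_separates:
  assumes "finite V" "e \<subseteq> V" "W \<subseteq> V" "W \<inter> e = {}" "j < n" "0 \<le> p" "p \<le> 1"
  shows "measure_pmf.prob (Pi_pmf (V \<times> {..<n}) False (\<lambda>_. bernoulli_pmf p)) (separates e W j) =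
         p ^ card e * (1 - p) ^ card W"
proof -
  let ?I = "V \<times> {..<n}"
  define B where "B = (\<lambda>x. if x \<in> e \<times> {j} then {True} else if x \<in> W \<times> {j} then {False} else UNIV)"
  let ?g = "\<lambda>x. measure_pmf.prob (bernoulli_pmf p) (B x)"
  have "separates e W j = Pi ?I B"
    using assms by (fastforce simp: separates_def B_def Pi_def split: if_splits)
  then have "measure_pmf.prob (Pi_pmf ?I False (\<lambda>_. bernoulli_pmf p)) (separates e W j) = prod ?g ?I"
    using assms by (simp add: measure_Pi_pmf_Pi)
  also have "\<dots> = prod ?g (e \<times> {j} \<union> W \<times> {j})"
    using assms by (intro prod.mono_neutral_right) (auto simp: B_def)
  also have "\<dots> = prod ?g (e \<times> {j}) * prod ?g (W \<times> {j})"
    using assms by (intro prod.union_disjoint) (auto dest: finite_subset)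
  also have "prod ?g (e \<times> {j}) = (\<Prod>x\<in>e \<times> {j}. p)"
    using assms by (intro prod.cong) (auto simp: B_def measure_pmf_single)
  also have "prod ?g (W \<times> {j}) = (\<Prod>x\<in>W \<times> {j}. 1 - p)"
    using assms by (intro prod.cong) (auto simp: B_def measure_pmf_single)
  finally show ?thesis
    by (simp add: card_cartesian_product)
qed

text \<open>The number \<open>k\<close> of inspected sets is kept apart from \<open>n\<close>, so
  that the induction runs inside one fixed probability space. Different indices \<open>j\<close> use
  disjoint coordinates.\<close>

lemma prob_never_separates:
  assumes "finite V" "e \<subseteq> V" "W \<subseteq> V" "W \<inter> e = {}" "k \<le> n" "0 \<le> p" "p \<le> 1"
  shows "measure_pmf.prob (Pi_pmf (V \<times> {..<n}) False (\<lambda>_. bernoulli_pmf p)) (never_separates e W k) =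
         (1 - p ^ card e * (1 - p) ^ card W) ^ k"
  using \<open>k \<le> n\<close>
proof (induction k)
  case 0
  then show ?case by (simp add: never_separates_def)
next
  case (Suc k)
  let ?M = "Pi_pmf (V \<times> {..<n}) False (\<lambda>_. bernoulli_pmf p)"
  have "never_separates e W (Suc k) = - separates e W k \<inter> never_separates e W k"
    by (auto simp: never_separates_def less_Suc_eq)
  also have "measure_pmf.prob ?M \<dots> =
      measure_pmf.prob ?M (- separates e W k) * measure_pmf.prob ?M (never_separates e W k)"
    using assms Suc.prems
    by (intro Pi_pmf_indep[of _ "(e \<union> W) \<times> {k}" "(e \<union> W) \<times> {..<k}"]
        depends_on_Compl depends_on_separates depends_on_never_separates) auto
  also have "measure_pmf.prob ?M (- separates e W k) = 1 - measure_pmf.prob ?M (separates e W k)"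
    using measure_pmf.prob_compl[of "separates e W k" ?M] by (simp add: Compl_eq_Diff_UNIV)
  also have "measure_pmf.prob ?M (separates e W k) = p ^ card e * (1 - p) ^ card W"
    using assms Suc.prems by (intro prob_separates) auto
  finally show ?case
    using Suc by simp
qed

section \<open>Counting the pairs of an edge and a disjoint \<open>w\<close>-set\<close>

definition constraints :: "'a set \<Rightarrow> 'a set set \<Rightarrow> nat \<Rightarrow> ('a set \<times> 'a set) set" where
  "constraints V E w = (SIGMA e:E. {W. W \<subseteq> V - e \<and> card W = w})"

lemma simple_graph_finite:
  assumes "simple_graph V E"
  shows "finite V" "finite E" "finite (constraints V E w)"
proof -
  show "finite V" using assms by (simp add: simple_graph_def)
  moreover have "E \<subseteq> Pow V"
    using assms by (auto simp: simple_graph_def)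
  ultimately show "finite E"
    using finite_subset by blast
  then show "finite (constraints V E w)"
    using \<open>finite V\<close> by (auto simp: constraints_def)
qed

lemma card_edges_meeting:
  assumes "simple_graph V E" "S \<subseteq> V"
  shows "card {e \<in> E. e \<inter> S \<noteq> {}} \<le> card S * max_degree V E"
proof -
  note fin = simple_graph_finite[OF assms(1)]
  have "card {e \<in> E. e \<inter> S \<noteq> {}} = card (\<Union>v\<in>S. {e \<in> E. v \<in> e})"
    by (rule arg_cong[where f = card]) auto
  also have "\<dots> \<le> (\<Sum>v\<in>S. card {e \<in> E. v \<in> e})"
    using assms fin by (intro card_UN_le) (auto dest: finite_subset)
  also have "\<dots> \<le> (\<Sum>v\<in>S. max_degree V E)"
    using assms fin unfolding Defs.degree_def[symmetric] max_degree_def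
    by (intro sum_mono Max_ge) auto
  finally show ?thesis
    by simp
qed

text \<open>An edge forces at least two vertices, so the cut-off in \<open>int_choose\<close>
  matters only when there is no edge, and then both sides vanish.\<close>

lemma card_constraints:
  assumes "simple_graph V E"
  shows "card (constraints V E w) = card E * int_choose (int (card V) - 2) w"
proof -
  note fin = simple_graph_finite[OF assms]
  have "card {W. W \<subseteq> V - e \<and> card W = w} = int_choose (int (card V) - 2) w" if "e \<in> E" for e
  proof -
    have e: "e \<subseteq> V" "card e = 2"
      using assms that by (auto simp: simple_graph_def)
    then have "2 \<le> card V" "card (V - e) = card V - 2"
      using fin card_mono[of V e] by (auto simp: card_Diff_subset finite_subset)
    then show ?thesis
      using fin n_subsets[of "V - e" w]
      by (simp add: int_choose_def nat_diff_distrib flip: of_nat_diff)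
  qed
  then show ?thesis
    using fin by (simp add: constraints_def card_SigmaI)
qed

text \<open>An edge \<open>e\<close> off \<open>S\<close> occupies \<open>w + 4\<close> vertices
  together with \<open>S\<close>, and \<open>W\<close> is chosen among the others. If no such edge
  exists, both sides are 0, whatever \<open>int_choose\<close> returns.\<close>

lemma card_constraints_disjoint:
  assumes "simple_graph V E" "S \<subseteq> V" "card S = w + 2"
  shows "card {(e, W) \<in> constraints V E w. (e \<union> W) \<inter> S = {}} =
         card {e \<in> E. e \<inter> S = {}} * int_choose (int (card V) - int w - 4) w"
proof -
  note fin = simple_graph_finite[OF assms(1)]
  have "card {W. W \<subseteq> V - (e \<union> S) \<and> card W = w} = int_choose (int (card V) - int w - 4) w"
    if "e \<in> E" "e \<inter> S = {}" for e
  proof -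
    have e: "e \<subseteq> V" "card e = 2"
      using assms that by (auto simp: simple_graph_def)
    have "card (e \<union> S) = w + 4"
      using that e assms fin by (subst card_Un_disjoint) (auto dest: finite_subset)
    then have "w + 4 \<le> card V" "card (V - (e \<union> S)) = card V - (w + 4)"
      using fin card_mono[of V "e \<union> S"] e assms
      by (auto simp: card_Diff_subset finite_subset)
    moreover have "nat (int (card V) - int w - 4) = card V - (w + 4)"
      by simp
    ultimately show ?thesis
      using fin n_subsets[of "V - (e \<union> S)" w] by (simp add: int_choose_def)
  qed
  moreover have "{(e, W) \<in> constraints V E w. (e \<union> W) \<inter> S = {}} =
      (SIGMA e:{e \<in> E. e \<inter> S = {}}. {W. W \<subseteq> V - (e \<union> S) \<and> card W = w})"
    by (auto simp: constraints_def)
  ultimately show ?thesis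
    using fin by (simp add: card_SigmaI)
qed

text \<open>The pairs that avoid \<open>S\<close> are subtracted from all pairs. The bound is over
  the reals because the number of edges minus \<open>(w + 2)\<close> times the maximum degree can be
  negative; it is still a lower bound for the number of edges off \<open>S\<close>.\<close>

lemma card_constraints_meeting:
  assumes "simple_graph V E" "S \<subseteq> V" "card S = w + 2"
  shows "real (card {(e, W) \<in> constraints V E w. (e \<union> W) \<inter> S \<noteq> {}}) \<le>
         real (card E) * real (int_choose (int (card V) - 2) w)
         - (real (card E) - (real w + 2) * real (max_degree V E))
           * real (int_choose (int (card V) - int w - 4) w)"
proof -
  note fin = simple_graph_finite[OF assms(1)]
  let ?C = "constraints V E w" and ?c = "int_choose (int (card V) - int w - 4) w"
  let ?near = "{(e, W) \<in> ?C. (e \<union> W) \<inter> S \<noteq> {}}" and ?far = "{(e, W) \<in> ?C. (e \<union> W) \<inter> S = {}}"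
  have "card ?C = card (?near \<union> ?far)"
    by (rule arg_cong[where f = card]) auto
  also have "\<dots> = card ?near + card ?far"
    by (rule card_Un_disjoint) (auto intro: finite_subset[OF _ fin(3)[of w]])
  finally have C: "real (card ?C) = real (card ?near) + real (card ?far)"
    by simp
  have "card E = card ({e \<in> E. e \<inter> S \<noteq> {}} \<union> {e \<in> E. e \<inter> S = {}})"
    by (rule arg_cong[where f = card]) auto
  also have "\<dots> = card {e \<in> E. e \<inter> S \<noteq> {}} + card {e \<in> E. e \<inter> S = {}}"
    using fin by (intro card_Un_disjoint) auto
  also have "\<dots> \<le> (w + 2) * max_degree V E + card {e \<in> E. e \<inter> S = {}}"
    using card_edges_meeting[OF assms(1,2)] assms(3) by simp
  finally have "real (card E) \<le> real ((w + 2) * max_degree V E + card {e \<in> E. e \<inter> S = {}})"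
    by (rule of_nat_mono)
  then have "real (card E) - (real w + 2) * real (max_degree V E) \<le> real (card {e \<in> E. e \<inter> S = {}})"
    by (simp add: algebra_simps)
  then have "(real (card E) - (real w + 2) * real (max_degree V E)) * real ?c \<le> real (card ?far)"
    unfolding card_constraints_disjoint[OF assms] of_nat_mult by (intro mult_right_mono) auto
  then show ?thesis
    using C by (simp add: card_constraints[OF assms(1)])
qed

section \<open>From the local lemma to coverings\<close>

lemma int_choose_mono: "a \<le> b \<Longrightarrow> int_choose a k \<le> int_choose b k"
  by (auto simp: int_choose_def intro!: binomial_right_mono)

lemma covering_number_le:
  assumes G: "simple_graph V E" and p: "0 \<le> p" "p \<le> 1"
    and d: "\<And>S. S \<subseteq> V \<Longrightarrow> card S = w + 2 \<Longrightarrow>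
      card {(e, W) \<in> constraints V E w. (e \<union> W) \<inter> S \<noteq> {}} \<le> d"
    and n: "exp 1 * (1 - p ^ 2 * (1 - p) ^ w) ^ n * (real d + 1) \<le> 1"
  shows "covering_number V E w 1 \<le> n"
proof -
  note fin = simple_graph_finite[OF G]
  let ?M = "Pi_pmf (V \<times> {..<n}) False (\<lambda>_. bernoulli_pmf p)"
  let ?C = "constraints V E w"
  define A where "A = (\<lambda>(e, W). never_separates e W n :: ('a \<times> nat \<Rightarrow> bool) set)"
  \<comment> \<open>Each pair in \<open>?C\<close> is its own neighbour, in line with the count in
    assumption \<open>d\<close>, applied below with \<open>S\<close> as
    \<open>e \<union> W\<close>.\<close>
  define \<Gamma> where "\<Gamma> = (\<lambda>(e, W). {(e', W'). (e' \<union> W') \<inter> (e \<union> W) \<noteq> ({} :: 'a set)})"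
  have C: "e \<in> E" "e \<subseteq> V" "card e = 2" "W \<subseteq> V" "W \<inter> e = {}" "card W = w" "card (e \<union> W) = w + 2"
    if "(e, W) \<in> ?C" for e W
  proof -
    show *: "e \<in> E" "e \<subseteq> V" "card e = 2" "W \<subseteq> V" "W \<inter> e = {}" "card W = w"
      using that G by (auto simp: constraints_def simple_graph_def)
    then show "card (e \<union> W) = w + 2"
      using fin by (subst card_Un_disjoint) (auto dest: finite_subset)
  qed
  have "0 < measure_pmf.prob ?M (space ?M - \<Union>(A ` ?C))"
  proof (rule measure_pmf.symmetric_local_lemma[OF fin(3)])
    show "A ` ?C \<subseteq> measure_pmf.events ?M"
      by simp
  next
    fix i assume i: "i \<in> ?C"
    obtain e W where [simp]: "i = (e, W)"
      by (cases i)
    note eW = C[OF i[simplified]]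
    show "measure_pmf.prob ?M (A i) \<le> (1 - p ^ 2 * (1 - p) ^ w) ^ n"
      using prob_never_separates[OF fin(1), of e W n n p] eW p by (simp add: A_def)
    have "\<Gamma> i \<inter> ?C = {(e', W') \<in> ?C. (e' \<union> W') \<inter> (e \<union> W) \<noteq> {}}"
      by (auto simp: \<Gamma>_def)
    then show "card (\<Gamma> i \<inter> ?C) \<le> d"
      using d[of "e \<union> W"] eW by simp
    fix S assume S: "S \<subseteq> ?C - insert i (\<Gamma> i)"
    \<comment> \<open>All events of non-neighbours live on the coordinates outside
      \<open>e \<union> W\<close>, hence so does any Boolean combination of them. This is stronger
      than pairwise independence.\<close>
    have "depends_on ((V - (e \<union> W)) \<times> {..<n}) (A k)" if "k \<in> S" for k
    proof -
      obtain e' W' where [simp]: "k = (e', W')"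
        by (cases k)
      have "k \<in> ?C" "k \<notin> \<Gamma> i"
        using S that by auto
      then have "e' \<union> W' \<subseteq> V - (e \<union> W)"
        using C[of e' W'] by (auto simp: \<Gamma>_def)
      then show ?thesis
        unfolding A_def using depends_on_mono[OF depends_on_never_separates]
        by (metis (no_types, lifting) Sigma_mono \<open>k = (e', W')\<close> case_prod_conv subset_refl)
    qed
    then have "depends_on ((V - (e \<union> W)) \<times> {..<n}) (- \<Union>(A ` S))"
      by (intro depends_on_Compl depends_on_UN)
    moreover have "depends_on ((e \<union> W) \<times> {..<n}) (A i)"
      by (simp add: A_def depends_on_never_separates)
    ultimately show "measure_pmf.prob ?M (A i \<inter> (space ?M - \<Union>(A ` S))) =
        measure_pmf.prob ?M (A i) * measure_pmf.prob ?M (space ?M - \<Union>(A ` S))"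
      using fin eW unfolding space_measure_pmf Compl_eq_Diff_UNIV[symmetric]
      by (intro Pi_pmf_indep[of _ "(e \<union> W) \<times> {..<n}" "(V - (e \<union> W)) \<times> {..<n}"]) auto
  qed (use n in simp)
  then have "space ?M - \<Union>(A ` ?C) \<noteq> {}"
    by (metis less_irrefl measure_empty)
  then obtain f where f: "\<And>e W. (e, W) \<in> ?C \<Longrightarrow> f \<notin> never_separates e W n"
    by (auto simp: A_def)
  \<comment> \<open>The outcome \<open>f\<close> that avoids all bad events is read off as a list of
    \<open>n\<close> subsets of \<open>V\<close>.\<close>
  define As where "As = map (\<lambda>j. {v \<in> V. f (v, j)}) [0..<n]"
  have "is_covering V E w 1 As"
    unfolding is_covering_def
  proof (intro conjI allI impI)
    fix u v W assume uvW: "{u, v} \<in> E \<and> W \<subseteq> V \<and> card W = w \<and> W \<inter> {u, v} = {}"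
    then have uv: "({u, v}, W) \<in> ?C"
      by (auto simp: constraints_def)
    from f[OF uv] obtain j where "j < n" "f \<in> separates {u, v} W j"
      by (auto simp: never_separates_def)
    then have "j \<in> {j. j < length As \<and> {u, v} \<subseteq> As ! j \<and> W \<inter> As ! j = {}}"
      using C(2)[OF uv] by (auto simp: As_def separates_def)
    then show "1 \<le> card {j. j < length As \<and> {u, v} \<subseteq> As ! j \<and> W \<inter> As ! j = {}}"
      by (auto simp: Suc_le_eq card_gt_0_iff)
  qed (auto simp: As_def)
  then show ?thesis
    unfolding covering_number_def by (intro Least_le exI[of _ As]) (simp add: As_def)
qed

theorem theorem3p12:
  fixes V :: "'a set" and E :: "'a set set"
    and t m \<Delta> w :: nat and p q D :: real
  assumes "simple_graph V E"
    and "card V = t" and "card E = m" and "max_degree V E = \<Delta>"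
    and "w > 0"
    and "0 < p" and "p < 1"
    and "q = 1 - p ^ 2 * (1 - p) ^ w"
    and "D = real m * real (int_choose (int t - 2) w)
           - (real m - (real w + 2) * real \<Delta>) * real (int_choose (int t - int w - 4) w)"
  shows "int (covering_number V E w 1) \<le> \<lceil>log 2 (exp 1 * (D + 1)) / (- log 2 q)\<rceil>"
proof -
  let ?x = "log 2 (exp 1 * (D + 1)) / (- log 2 q)"
  \<comment> \<open>\<open>nat\<close> does not change the ceiling, since \<open>?x\<close> is shown
    to be nonnegative at the end.\<close>
  define n where "n = nat \<lceil>?x\<rceil>"
  \<comment> \<open>The local lemma wants a natural number as degree. A cardinality that is at most
    \<open>D\<close> is also at most its floor.\<close>
  define d where "d = nat \<lfloor>D\<rfloor>"
  have "0 < p ^ 2 * (1 - p) ^ w"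
    using assms by simp
  moreover have "p ^ 2 * (1 - p) ^ w < 1"
  proof -
    have "p ^ 2 * (1 - p) ^ w \<le> p ^ 2"
      using assms by (intro mult_left_le power_le_one) auto
    also have "p ^ 2 < 1"
      using assms by (simp add: power_less_one_iff)
    finally show ?thesis .
  qed
  ultimately have q: "0 < q" "q < 1"
    using assms by auto
  have "int_choose (int t - int w - 4) w \<le> int_choose (int t - 2) w"
    by (rule int_choose_mono) simp
  then have "real m * real (int_choose (int t - int w - 4) w) \<le> real m * real (int_choose (int t - 2) w)"
    by (intro mult_left_mono) auto
  moreover have "0 \<le> (real w + 2) * real \<Delta> * real (int_choose (int t - int w - 4) w)"
    by simp
  \<comment> \<open>The larger binomial coefficient carries the factor \<open>m\<close>, and the
    term with \<open>\<Delta>\<close> enters \<open>D\<close> with a positive sign.\<close>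
  ultimately have D: "0 \<le> D"
    unfolding assms(9) left_diff_distrib by linarith
  then have "1 \<le> exp 1 * (D + 1)"
    using mult_mono[of 1 "exp 1" 1 "D + 1"] by simp
  then have pos: "0 < exp 1 * (D + 1)" and ln: "0 \<le> ln (exp 1 * (D + 1))"
    by (linarith, rule ln_ge_zero)
  \<comment> \<open>The base 2 cancels. Clearing the positive denominator and exponentiating then
    turns \<open>?x \<le> real n\<close> into the condition of the local lemma.\<close>
  have "?x = ln (exp 1 * (D + 1)) / (- ln q)"
    by (simp add: log_def)
  moreover have "?x \<le> real n"
    unfolding n_def by linarith
  ultimately have "ln (exp 1 * (D + 1)) / (- ln q) \<le> real n"
    by metis
  moreover have "0 < - ln q"
    using q by simp
  ultimately have "ln (exp 1 * (D + 1)) \<le> real n * (- ln q)"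
    by (metis pos_divide_le_eq)
  then have "ln (exp 1 * (D + 1) * q ^ n) \<le> 0"
    using q pos by (subst ln_mult_pos) (auto simp: ln_realpow)
  then have "exp 1 * (D + 1) * q ^ n \<le> 1"
    using q pos ln_le_zero_iff[of "exp 1 * (D + 1) * q ^ n"] by (simp only: mult_pos_pos zero_less_power)
  then have "exp 1 * q ^ n * (D + 1) \<le> 1"
    by (simp only: mult_ac)
  moreover have "exp 1 * q ^ n * (real d + 1) \<le> exp 1 * q ^ n * (D + 1)"
    using q D by (intro mult_left_mono) (auto simp: d_def)
  ultimately have "exp 1 * q ^ n * (real d + 1) \<le> 1"
    by linarith
  moreover have "card {(e, W) \<in> constraints V E w. (e \<union> W) \<inter> S \<noteq> {}} \<le> d"
    if "S \<subseteq> V" "card S = w + 2" for S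
    using card_constraints_meeting[OF assms(1) that] assms(2,3,4,9) D
    unfolding d_def by (simp add: le_nat_iff le_floor_iff)
  ultimately have "covering_number V E w 1 \<le> n"
    using assms by (intro covering_number_le[of V E p w d n]) auto
  moreover have "0 \<le> ?x"
    using ln q by (simp add: log_def divide_nonneg_neg)
  ultimately show ?thesis
    unfolding n_def by linarith
qed

end
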